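(* Let $\lambda\in\,]0,1[$, let $f_0:=\mathrm{ent}$ be the negative Boltzmann--Shannon entropy on $\mathbb{R}$ and let $f_1:=\tfrac12(\cdot)^2$ on $\mathbb{R}$. Let $f_\lambda:=\mathcal{P}(f_0,\lambda,f_1)$ be their proximal average. Then for every $x\in\mathbb{R}$, $$ \begin{aligned} f_\lambda(x) ={}& \frac{\lambda-1}{2}\,\mathcal{W}\!\left(e^{\frac{2\lambda-2}{2-\lambda}\mathcal{W}\left(\left(\frac{2}{\lambda}-1\right)e^{\frac{2x}{\lambda}}\right)+\frac{2x}{\lambda}}\right)^2 - \frac{x^2(\lambda-2)}{2\lambda}\\ &+(\lambda-1)\,\mathcal{W}\!\left(e^{\frac{2\lambda-2}{2-\lambda}\mathcal{W}\left(\left(\frac{2}{\lambda}-1\right)e^{\frac{2x}{\lambda}}\right)+\frac{2x}{\lambda}}\right) - \frac{\lambda(\lambda-1)^2}{(\lambda-2)^2}\,\mathcal{W}\!\left(\left(\tfrac{2}{\lambda}-1\right)e^{\frac{2x}{\lambda}}\right)^2 . \end{aligned} $$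
   Context: $\mathcal{W}$ denotes the principal real branch of the Lambert W function, i.e. the inverse of $x\mapsto xe^x$; for $z>0$, $\mathcal{W}(z)$ is the unique $w>0$ with $we^w=z$. The negative Boltzmann--Shannon entropy is $\mathrm{ent}:\mathbb{R}\to\mathbb{R}\cup\{\infty\}$ with $\mathrm{ent}(x)=x\log x-x$ for $x>0$, $\mathrm{ent}(0)=0$, and $\mathrm{ent}(x)=\infty$ for $x<0$. The Fenchel conjugate of $f:\mathbb{R}\to[-\infty,\infty]$ is $f^*(x)=\sup_{y\in\mathbb{R}}\{xy-f(y)\}$. For convex, lower semicontinuous, proper functions $f_0,f_1:\mathbb{R}\to\,]-\infty,\infty]$ and $\lambda\in[0,1]$, the proximal average is $$\mathcal{P}(f_0,\lambda,f_1)=\left((1-\lambda)\left(f_0+\tfrac12(\cdot)^2\right)^*+\lambda\left(f_1+\tfrac12(\cdot)^2\right)^*\right)^*-\tfrac12(\cdot)^2 .$$ *)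

theory Defs
  imports Complex_Main "HOL-Library.Extended_Real"
begin

text \<open>
  Principal real branch of the Lambert W function: the inverse of \<open>w \<mapsto> w e\<^sup>w\<close> on \<open>[-1, \<infinity>[\<close>,
  where this map is injective with range \<open>[-1/e, \<infinity>[\<close>. The value is unspecified elsewhere.
\<close>

definition Lambert_W :: "real \<Rightarrow> real" where
  "Lambert_W = the_inv_into {-1..} (\<lambda>w. w * exp w)"

definition ent :: "real \<Rightarrow> ereal" where
  "ent x = (if x > 0 then ereal (x * ln x - x) else if x = 0 then 0 else \<infinity>)"

definition half_sq :: "real \<Rightarrow> ereal" where
  "half_sq x = ereal (x\<^sup>2 / 2)"

text \<open>
  The subtraction is never of the form \<open>\<infinity> - \<infinity>\<close>, since the first term is finite.
\<close>

definition fenchel_conj :: "(real \<Rightarrow> ereal) \<Rightarrow> real \<Rightarrow> ereal" where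
  "fenchel_conj f x = (SUP y. ereal (x * y) - f y)"

text \<open>
  Meant for convex, lower semicontinuous, proper \<open>f\<^sub>0\<close> and \<open>f\<^sub>1\<close> and \<open>0 \<le> l \<le> 1\<close>. For such functions
  the two inner conjugates are real-valued, so the indeterminate sums and products of type
  \<^typ>\<open>ereal\<close>, such as \<open>\<infinity> + -\<infinity>\<close> and \<open>0 * \<infinity>\<close>, do not occur.
\<close>

definition proximal_average :: "(real \<Rightarrow> ereal) \<Rightarrow> real \<Rightarrow> (real \<Rightarrow> ereal) \<Rightarrow> real \<Rightarrow> ereal" where
  "proximal_average f\<^sub>0 l f\<^sub>1 x =
     fenchel_conj
       (\<lambda>u. ereal (1 - l) * fenchel_conj (\<lambda>y. f\<^sub>0 y + half_sq y) u
          + ereal l * fenchel_conj (\<lambda>y. f\<^sub>1 y + half_sq y) u) x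
     - half_sq x"

end

theory Submission
  imports Defs
begin

text \<open>
  For a convex function \<open>f\<close> with subgradient \<open>x\<close> at \<open>p\<close>, the supremum defining \<open>f\<^sup>*(x)\<close> is attained
  at \<open>p\<close>, so \<open>f\<^sup>*(x) = x p - f(p)\<close>. All three conjugates in the proximal average are evaluated this
  way (lemma \<open>fenchel_conj_eq_of_subgradient\<close>).

  For \<open>ent + (\<cdot>)\<^sup>2/2\<close> and slope \<open>u\<close> the maximiser is the solution \<open>w = \<W>(e\<^sup>u)\<close> of \<open>w + ln w = u\<close>,
  and the conjugate is \<open>w\<^sup>2/2 + w\<close>. For \<open>(\<cdot>)\<^sup>2/2 + (\<cdot>)\<^sup>2/2\<close> the conjugate is \<open>u\<^sup>2/4\<close>. The outer conjugate
  at \<open>x\<close> is attained where \<open>(1 - l) w + l u / 2 = x\<close> with \<open>u = w + ln w\<close>. Eliminating \<open>u\<close> turns this into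
  \<open>a w + ln w = 2 x / l\<close> with \<open>a = 2 / l - 1\<close>, that is, \<open>a w = \<W>(a e\<^bsup>2x/l\<^esup>)\<close>. Substituting
  gives \<open>u = (2 l - 2) / (2 - l) \<W>(a e\<^bsup>2x/l\<^esup>) + 2 x / l\<close>, and the formula follows by algebra.
\<close>

lemma strict_mono_on_mult_exp: "strict_mono_on {-1..} (\<lambda>w::real. w * exp w)"
proof (rule strict_mono_onI)
  fix a b :: real
  assume ab: "a \<in> {-1..}" "b \<in> {-1..}" "a < b"
  have "a * exp (- (b - a)) < b"
  proof (cases "a < 0")
    case True
    have "1 - (b - a) < exp (- (b - a))"
      using ab exp_minus_greater[of "b - a"] by simp
    then have "a * exp (- (b - a)) < a * (1 - (b - a))"
      using True by (simp add: mult_less_cancel_left)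
    also have "\<dots> = a + (- a) * (b - a)" by (simp add: algebra_simps)
    also have "\<dots> \<le> a + 1 * (b - a)"
      using ab by (intro add_left_mono mult_right_mono) auto
    finally show ?thesis by simp
  next
    case False
    then have "a * exp (- (b - a)) \<le> a * 1"
      using ab by (intro mult_left_mono) auto
    then show ?thesis using ab by simp
  qed
  then have "a * exp (- (b - a)) * exp b < b * exp b" by simp
  then show "a * exp a < b * exp b"
    by (simp add: mult.assoc flip: exp_add)
qed

lemma Lambert_W_mult_exp:
  assumes "-1 \<le> w"
  shows "Lambert_W (w * exp w) = w"
  unfolding Lambert_W_def
  using the_inv_into_f_f[OF strict_mono_on_imp_inj_on[OF strict_mono_on_mult_exp]] assms
  by simp

lemma obtain_mult_exp_eq:
  fixes z :: real
  assumes "0 < z"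
  obtains w where "0 < w" "w * exp w = z"
proof -
  have "z * 1 \<le> z * exp z" using assms by (intro mult_left_mono) auto
  then have "\<exists>w\<ge>0. w \<le> z \<and> w * exp w = z"
    using assms by (intro IVT') (auto intro!: continuous_intros)
  then show ?thesis using that assms by (metis less_eq_real_def mult_zero_left)
qed

text \<open>Equality in the Fenchel--Young inequality at a subgradient.\<close>

lemma fenchel_conj_eq_of_subgradient:
  assumes "f p = ereal r"
    and "\<And>y. ereal (r + x * (y - p)) \<le> f y"
  shows "fenchel_conj f x = ereal (x * p - r)"
  unfolding fenchel_conj_def
proof (rule antisym[OF SUP_least SUP_upper2[of p]])
  fix y
  have "ereal (x * y) - f y \<le> ereal (x * y) - ereal (r + x * (y - p))"
    using assms(2) by (rule ereal_minus_mono[OF order_refl])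
  then show "ereal (x * y) - f y \<le> ereal (x * p - r)" by (simp add: algebra_simps)
qed (simp_all add: assms(1))

lemma mult_ln_tangent_bound:
  fixes w y :: real
  assumes "0 < w" "0 \<le> y"
  shows "y * (ln w - ln y) \<le> w - y"
proof (cases "y = 0")
  case False
  with assms have "0 < y" by simp
  then have "ln w - ln y \<le> w / y - 1"
    using ln_le_minus_one[of "w / y"] assms by (simp add: ln_div)
  then have "y * (ln w - ln y) \<le> y * (w / y - 1)"
    using \<open>0 < y\<close> by (intro mult_left_mono) auto
  also have "\<dots> = w - y" using \<open>0 < y\<close> by (simp add: field_simps)
  finally show ?thesis .
qed (use assms in simp)

lemma fenchel_conj_ent_half_sq:
  assumes "0 < w"
  shows "fenchel_conj (\<lambda>y. ent y + half_sq y) (w + ln w) = ereal (w\<^sup>2 / 2 + w)"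
proof -
  let ?r = "w * ln w - w + w\<^sup>2 / 2"
  have "fenchel_conj (\<lambda>y. ent y + half_sq y) (w + ln w) = ereal ((w + ln w) * w - ?r)"
  proof (rule fenchel_conj_eq_of_subgradient)
    show "ent w + half_sq w = ereal ?r" using assms by (simp add: ent_def half_sq_def)
  next
    fix y :: real
    show "ereal (?r + (w + ln w) * (y - w)) \<le> ent y + half_sq y"
    proof (cases "0 \<le> y")
      case True
      have "0 \<le> (y - w)\<^sup>2" by simp
      then have "?r + (w + ln w) * (y - w) \<le> y * ln y - y + y\<^sup>2 / 2"
        using mult_ln_tangent_bound[OF assms True]
        by (simp add: algebra_simps power2_eq_square)
      moreover have "ent y + half_sq y = ereal (y * ln y - y + y\<^sup>2 / 2)"
        using True by (auto simp: ent_def half_sq_def)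
      ultimately show ?thesis by simp
    qed (simp add: ent_def half_sq_def)
  qed
  also have "(w + ln w) * w - ?r = w\<^sup>2 / 2 + w" by (simp add: algebra_simps power2_eq_square)
  finally show ?thesis .
qed

lemma fenchel_conj_half_sq_half_sq:
  "fenchel_conj (\<lambda>y. half_sq y + half_sq y) u = ereal (u\<^sup>2 / 4)"
proof -
  have "fenchel_conj (\<lambda>y. half_sq y + half_sq y) u = ereal (u * (u / 2) - u\<^sup>2 / 4)"
  proof (rule fenchel_conj_eq_of_subgradient)
    show "half_sq (u / 2) + half_sq (u / 2) = ereal (u\<^sup>2 / 4)"
      by (simp add: half_sq_def power2_eq_square)
  next
    fix y :: real
    have "0 \<le> (y - u / 2)\<^sup>2" by simp
    then show "ereal (u\<^sup>2 / 4 + u * (y - u / 2)) \<le> half_sq y + half_sq y"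
      by (simp add: half_sq_def power2_eq_square algebra_simps)
  qed
  then show ?thesis by (simp add: power2_eq_square)
qed

text \<open>
  \<open>w\<close> is a subgradient of \<open>v \<mapsto> (ent + (\<cdot>)\<^sup>2/2)\<^sup>*(v)\<close> at \<open>w + ln w\<close>. The conjugate is written through
  the substitution \<open>v = t + ln t\<close>, which maps the positive reals onto all reals.
\<close>

lemma conj_ent_half_sq_subgradient:
  fixes w t :: real
  assumes "0 < w" "0 < t"
  shows "w\<^sup>2 / 2 + w + w * ((t + ln t) - (w + ln w)) \<le> t\<^sup>2 / 2 + t"
proof -
  have "0 \<le> (t - w)\<^sup>2" by simp
  then show ?thesis
    using mult_ln_tangent_bound[of t w] assms by (simp add: algebra_simps power2_eq_square)
qed

lemma obtain_add_ln_eq: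
  fixes u :: real
  obtains w where "0 < w" "w + ln w = u"
proof -
  obtain w where w: "0 < w" "w * exp w = exp u" using obtain_mult_exp_eq[of "exp u"] by auto
  then have "ln (w * exp w) = u" by simp
  then have "w + ln w = u" using w(1) by (simp add: ln_mult)
  then show ?thesis using that w(1) by blast
qed

lemma proximal_average_ent_half_sq:
  assumes "0 \<le> l" "l \<le> 1" "0 < w"
    and x: "x = (1 - l) * w + l * (w + ln w) / 2"
  shows "proximal_average ent l half_sq x =
    ereal (x * (w + ln w) - ((1 - l) * (w\<^sup>2 / 2 + w) + l * (w + ln w)\<^sup>2 / 4) - x\<^sup>2 / 2)"
proof -
  let ?g = "\<lambda>u. ereal (1 - l) * fenchel_conj (\<lambda>y. ent y + half_sq y) u
              + ereal l * fenchel_conj (\<lambda>y. half_sq y + half_sq y) u"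
  let ?G = "\<lambda>t. (1 - l) * (t\<^sup>2 / 2 + t) + l * (t + ln t)\<^sup>2 / 4"
  have g: "?g (t + ln t) = ereal (?G t)" if "0 < t" for t
    using fenchel_conj_ent_half_sq[OF that] fenchel_conj_half_sq_half_sq by simp
  have "fenchel_conj ?g x = ereal (x * (w + ln w) - ?G w)"
  proof (rule fenchel_conj_eq_of_subgradient)
    show "?g (w + ln w) = ereal (?G w)" using g assms by blast
  next
    fix u :: real
    obtain t where t: "0 < t" "t + ln t = u" by (rule obtain_add_ln_eq[of u])
    define v where "v = w + ln w"
    have "(1 - l) * (w\<^sup>2 / 2 + w + w * (u - v)) \<le> (1 - l) * (t\<^sup>2 / 2 + t)"
      using conj_ent_half_sq_subgradient[of w t] t assms
      unfolding v_def by (intro mult_left_mono) auto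
    moreover have "l * (v\<^sup>2 / 4 + v / 2 * (u - v)) \<le> l * (u\<^sup>2 / 4)"
    proof (rule mult_left_mono[OF _ \<open>0 \<le> l\<close>])
      have "0 \<le> (u - v)\<^sup>2" by simp
      then show "v\<^sup>2 / 4 + v / 2 * (u - v) \<le> u\<^sup>2 / 4"
        by (simp add: field_simps power2_eq_square)
    qed
    moreover have "x * (u - v) = (1 - l) * (w * (u - v)) + l * (v / 2 * (u - v))"
      unfolding x v_def[symmetric] by (simp add: field_simps)
    ultimately have "?G w + x * (u - (w + ln w)) \<le> ?G t"
      unfolding v_def[symmetric] t(2) by (simp add: distrib_left)
    then show "ereal (?G w + x * (u - (w + ln w))) \<le> ?g u"
      using g[OF t(1)] unfolding t(2) by simp
  qed
  then show ?thesis by (simp add: proximal_average_def half_sq_def)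
qed

theorem theorem3p5:
  fixes l :: real
  assumes "0 < l" and "l < 1"
  shows "\<forall>x::real.
    proximal_average ent l half_sq x = ereal (
        (l - 1) / 2 *
          (Lambert_W (exp ((2 * l - 2) / (2 - l) * Lambert_W ((2 / l - 1) * exp (2 * x / l))
                           + 2 * x / l)))\<^sup>2
      - x\<^sup>2 * (l - 2) / (2 * l)
      + (l - 1) *
          Lambert_W (exp ((2 * l - 2) / (2 - l) * Lambert_W ((2 / l - 1) * exp (2 * x / l))
                          + 2 * x / l))
      - l * (l - 1)\<^sup>2 / (l - 2)\<^sup>2 * (Lambert_W ((2 / l - 1) * exp (2 * x / l)))\<^sup>2)"
proof
  fix x :: real
  \<comment> \<open>Solve the optimality condition \<open>a w + ln w = 2 x / l\<close> through \<open>V = a w\<close>.\<close>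
  define a where "a = 2 / l - 1"
  have "0 < a" using assms by (simp add: a_def field_simps)
  obtain V where V: "0 < V" "V * exp V = a * exp (2 * x / l)"
    using obtain_mult_exp_eq[of "a * exp (2 * x / l)"] \<open>0 < a\<close> by auto
  then have WV: "Lambert_W (a * exp (2 * x / l)) = V"
    using Lambert_W_mult_exp[of V] by simp
  define w where "w = V / a"
  have "0 < w" using V \<open>0 < a\<close> by (simp add: w_def)
  have w: "w = l * V / (2 - l)" using assms by (simp add: w_def a_def field_simps)
  define u where "u = (2 * l - 2) / (2 - l) * V + 2 * x / l"
  have "w * exp V = exp (2 * x / l)" using V \<open>0 < a\<close> by (simp add: w_def field_simps)
  then have "ln (w * exp V) = 2 * x / l" by simp
  then have "ln w = 2 * x / l - V" using \<open>0 < w\<close> by (simp add: ln_mult)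
  moreover have "w - V = (2 * l - 2) / (2 - l) * V" using assms by (simp add: w field_simps)
  ultimately have u: "w + ln w = u" by (simp add: u_def)
  then have "exp u = w * exp w" using \<open>0 < w\<close> by (simp add: exp_add flip: u)
  then have Ww: "Lambert_W (exp u) = w" using Lambert_W_mult_exp[of w] \<open>0 < w\<close> by simp
  have "(2 * l - 2) / (2 - l) * V = - (2 * (1 - l) * w / l)"
    using assms by (simp add: w field_simps)
  then have "u = 2 * x / l - 2 * (1 - l) * w / l" by (simp add: u_def)
  then have "x = (1 - l) * w + l * u / 2" using assms by (simp add: field_simps)
  then have "proximal_average ent l half_sq x =
      ereal (x * u - ((1 - l) * (w\<^sup>2 / 2 + w) + l * u\<^sup>2 / 4) - x\<^sup>2 / 2)"
    using proximal_average_ent_half_sq[of l w x] assms \<open>0 < w\<close> unfolding u by simp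
  also have "x * u - ((1 - l) * (w\<^sup>2 / 2 + w) + l * u\<^sup>2 / 4) - x\<^sup>2 / 2 =
      (l - 1) / 2 * w\<^sup>2 - x\<^sup>2 * (l - 2) / (2 * l) + (l - 1) * w
      - l * (l - 1)\<^sup>2 / (l - 2)\<^sup>2 * V\<^sup>2"
  proof -
    \<comment> \<open>The cross terms \<open>x c V\<close> of \<open>x u\<close> and \<open>l u\<^sup>2 / 4\<close> cancel.\<close>
    define c where "c = (l - 1) / (l - 2)"
    have "(2 * l - 2) / (2 - l) = - 2 * c" using assms by (simp add: c_def field_simps)
    then have "u = 2 * x / l - 2 * c * V" by (simp add: u_def)
    then have "x * u - l * u\<^sup>2 / 4 = x\<^sup>2 / l - l * c\<^sup>2 * V\<^sup>2"
      using assms by (simp only:) (simp add: field_simps power2_eq_square)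
    moreover have "x\<^sup>2 / l - x\<^sup>2 / 2 = - (x\<^sup>2 * (l - 2) / (2 * l))"
      using assms by (simp add: field_simps)
    moreover have "l * (l - 1)\<^sup>2 / (l - 2)\<^sup>2 * V\<^sup>2 = l * c\<^sup>2 * V\<^sup>2"
      by (simp add: c_def power_divide)
    moreover have "(1 - l) * (w\<^sup>2 / 2 + w) = - ((l - 1) / 2 * w\<^sup>2) - (l - 1) * w"
      by (simp add: field_simps)
    ultimately show ?thesis by linarith
  qed
  finally show "proximal_average ent l half_sq x = ereal (
        (l - 1) / 2 *
          (Lambert_W (exp ((2 * l - 2) / (2 - l) * Lambert_W ((2 / l - 1) * exp (2 * x / l))
                           + 2 * x / l)))\<^sup>2
      - x\<^sup>2 * (l - 2) / (2 * l)
      + (l - 1) *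
          Lambert_W (exp ((2 * l - 2) / (2 - l) * Lambert_W ((2 / l - 1) * exp (2 * x / l))
                          + 2 * x / l))
      - l * (l - 1)\<^sup>2 / (l - 2)\<^sup>2 * (Lambert_W ((2 / l - 1) * exp (2 * x / l)))\<^sup>2)"
    unfolding a_def[symmetric] WV u_def[symmetric] Ww .
qed

end
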